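(* Let $t\ge 1$ be an integer. The ordinary generating function, with respect to length, of GDAP (including the empty path) all of whose vertices have ordinate between $-t$ and $t$ (inclusive) is $$\frac{D_{t-1}}{D_{2t}}\left(D_t+N_{t+1}^t\right),$$ where $(D_s)_{s\ge 0}$ is the sequence of polynomials in $x$ defined by $D_0=1$, $D_1=1-x^2$ and $D_{s+2}+(x^2-x-1)D_{s+1}+xD_s=0$ for $s\ge 0$, and $$N_{t+1}^t=\frac{2^{t+2}x^{t+3}(-1)^t}{W(x^2-x-1)^2-W^3}\left(\frac{1}{(x^2-x-1+W)^t}-\frac{1}{(x^2-x-1-W)^t}\right),\qquad W=\sqrt{x^4-2x^3-x^2-2x+1}.$$
   Context: A grand Dyck path with air pockets (GDAP) is a lattice path in $\mathbb{Z}^2$ starting at $(0,0)$ and ending on the $x$-axis, consisting of up-steps $U=(1,1)$ and down-steps $D_k=(1,-k)$ with $k\ge 1$, such that no two down-steps are consecutive; the path may go below the $x$-axis, and the empty path is a GDAP. The length of a path is its number of steps. $W$ denotes the formal power series square root with constant term $1$. *)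

theory Defs
  imports
    Complex_Main
    "HOL-Computational_Algebra.Computational_Algebra"
    "HOL-Library.Product_Plus"
begin

text \<open>A lattice path starting at the origin is given by its list of steps in
  \<open>\<int> \<times> \<int>\<close>; its length is the length of that list.\<close>

definition up_step :: "int \<times> int" where
  "up_step = (1, 1)"

definition down_steps :: "(int \<times> int) set" where
  "down_steps = {(1, - k) | k. k \<ge> 1}"

text \<open>The vertices include both end points, the origin being the empty partial sum.\<close>

definition path_vertices :: "(int \<times> int) list \<Rightarrow> (int \<times> int) set" where
  "path_vertices p = {sum_list (take i p) | i. i \<le> length p}"

definition gdap :: "(int \<times> int) list \<Rightarrow> bool" where
  "gdap p \<longleftrightarrow>
     set p \<subseteq> insert up_step down_steps \<and>
     successively (\<lambda>a b. \<not> (a \<in> down_steps \<and> b \<in> down_steps)) p \<and>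
     snd (sum_list p) = 0"

definition bounded_gdaps :: "nat \<Rightarrow> nat \<Rightarrow> (int \<times> int) list set" where
  "bounded_gdaps t n =
     {p. gdap p \<and> length p = n \<and> (\<forall>v \<in> path_vertices p. - int t \<le> snd v \<and> snd v \<le> int t)}"

text \<open>There are infinitely many admissible steps, but finitely many paths of a given length
  in the strip, so the cardinalities in the generating function below are genuine.\<close>

lemma finite_bounded_gdaps: "finite (bounded_gdaps t n)"
proof -
  let ?S = "{1} \<times> {- 2 * int t .. 1} :: (int \<times> int) set"
  have "bounded_gdaps t n \<subseteq> {p. set p \<subseteq> ?S \<and> length p = n}"
  proof
    fix p assume p: "p \<in> bounded_gdaps t n"
    have "x \<in> ?S" if "x \<in> set p" for x
    proof -
      obtain i where i: "i < length p" "p ! i = x"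
        using \<open>x \<in> set p\<close> unfolding in_set_conv_nth by (elim exE conjE)
      have vertex: "sum_list (take j p) \<in> path_vertices p" if "j \<le> length p" for j
        unfolding path_vertices_def using that by (intro CollectI exI conjI) (rule refl)
      have "sum_list (take i p) \<in> path_vertices p"
        by (rule vertex) (use i in simp)
      moreover have "sum_list (take (Suc i) p) \<in> path_vertices p"
        by (rule vertex) (use i in simp)
      ultimately have "snd (sum_list (take i p)) \<le> int t"
        and "- int t \<le> snd (sum_list (take (Suc i) p))"
        using p unfolding bounded_gdaps_def by blast+
      moreover have "snd (sum_list (take (Suc i) p)) = snd (sum_list (take i p)) + snd x"
        using i by (simp add: take_Suc_conv_app_nth)
      moreover have "x \<in> insert up_step down_steps"
        using p that by (auto simp: bounded_gdaps_def gdap_def)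
      ultimately show ?thesis
        by (auto simp: up_step_def down_steps_def)
    qed
    with p show "p \<in> {p. set p \<subseteq> ?S \<and> length p = n}"
      by (auto simp: bounded_gdaps_def)
  qed
  moreover have "finite {p. set p \<subseteq> ?S \<and> length p = n}"
    by (rule finite_lists_length_eq) simp
  ultimately show ?thesis
    by (rule finite_subset)
qed

definition bounded_gdap_gf :: "nat \<Rightarrow> real fps" where
  "bounded_gdap_gf t = Abs_fps (\<lambda>n. of_nat (card (bounded_gdaps t n)))"

fun D_poly :: "nat \<Rightarrow> real poly" where
  "D_poly 0 = 1"
| "D_poly (Suc 0) = 1 - monom 1 2"
| "D_poly (Suc (Suc s)) =
     - ((monom 1 2 - monom 1 1 - 1) * D_poly (Suc s)) - monom 1 1 * D_poly s"

lemma D_poly_recurrence: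
  "D_poly (s + 2) + (monom 1 2 - monom 1 1 - 1) * D_poly (s + 1) + monom 1 1 * D_poly s = 0"
  by simp

definition W_fps :: "real fps" where
  "W_fps = fps_radical root 2 (fps_X ^ 4 - 2 * fps_X ^ 3 - fps_X ^ 2 - 2 * fps_X + 1)"

lemma W_fps_nth_0: "fps_nth W_fps 0 = 1"
  by (simp add: W_fps_def)

lemma W_fps_square:
  "W_fps ^ 2 = fps_X ^ 4 - 2 * fps_X ^ 3 - fps_X ^ 2 - 2 * fps_X + 1" (is "_ = ?P")
proof -
  have "fps_nth ?P 0 = 1"
    by simp
  then have "fps_radical root (Suc 1) ?P ^ Suc 1 = ?P"
    by (intro iffD1[OF power_radical])
       (simp_all only: Suc_1 real_root_one one_neq_zero power_one zero_less_numeral not_False_eq_True)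
  then show ?thesis
    by (simp only: W_fps_def Suc_1)
qed

text \<open>The closed formula is read in the field of Laurent series: both
  \<open>x\<^sup>2 - x - 1 + W\<close> and \<open>W (x\<^sup>2 - x - 1)\<^sup>2 - W\<^sup>3 = 4 x W\<close> have
  vanishing constant term, so they are not invertible as power series.\<close>

definition D_fls :: "nat \<Rightarrow> real fls" where
  "D_fls s = fps_to_fls (fps_of_poly (D_poly s))"

definition W_fls :: "real fls" where
  "W_fls = fps_to_fls W_fps"

text \<open>\<open>N_fls t\<close> is $N_{t+1}^t$, where the upper index $t$ is a superscript and not a power.\<close>

definition N_fls :: "nat \<Rightarrow> real fls" where
  "N_fls t =
     2 ^ (t + 2) * fls_X ^ (t + 3) * (- 1) ^ t
       / (W_fls * (fls_X ^ 2 - fls_X - 1) ^ 2 - W_fls ^ 3)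
     * (1 / (fls_X ^ 2 - fls_X - 1 + W_fls) ^ t - 1 / (fls_X ^ 2 - fls_X - 1 - W_fls) ^ t)"

end

theory Submission
  imports Defs
begin

text \<open>Let \<open>F\<^sub>h\<close> count the paths in the strip from height \<open>h\<close> to height \<open>0\<close>, and \<open>G\<^sub>h\<close> those
  that may follow a down-step. Splitting off the first step gives
  \<open>G\<^sub>h = [h = 0] + x F\<^sub>h\<^sub>+\<^sub>1\<close> and \<open>F\<^sub>h = G\<^sub>h + x (G\<^sub>-\<^sub>t + \<dots> + G\<^sub>h\<^sub>-\<^sub>1)\<close>. Taking differences in \<open>h\<close>
  removes the sum and leaves a recurrence of order two for \<open>F\<close>, the one defining the \<open>D\<^sub>s\<close>, with
  inhomogeneities only near \<open>h = 0\<close>. Solving it downwards from \<open>F\<^sub>t\<^sub>+\<^sub>1 = 0\<close> in terms of the unknown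
  \<open>F\<^sub>t\<close>, the boundary condition \<open>F\<^sub>-\<^sub>t = x F\<^sub>1\<^sub>-\<^sub>t\<close> determines \<open>F\<^sub>t\<close> and hence \<open>F\<^sub>0\<close>. Let \<open>U\<close> be the solution
  with initial values \<open>0, 1\<close>. The roots of the characteristic polynomial have product \<open>x\<close> and
  difference \<open>W\<close>, so Binet's formula identifies \<open>x\<^sup>2 U\<^sub>t\<close> with \<open>N\<close>.\<close>

section \<open>Paths in the strip\<close>

text \<open>The starting height \<open>h\<close> is a parameter, so that removing the first step
  leaves an object of the same kind.\<close>

definition strip_paths :: "nat \<Rightarrow> int \<Rightarrow> nat \<Rightarrow> (int \<times> int) list set" where
  "strip_paths t h n =
     {p. set p \<subseteq> insert up_step down_steps \<and>
         successively (\<lambda>a b. \<not> (a \<in> down_steps \<and> b \<in> down_steps)) p \<and>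
         length p = n \<and> h + snd (sum_list p) = 0 \<and>
         (\<forall>i \<le> length p. \<bar>h + snd (sum_list (take i p))\<bar> \<le> int t)}"

definition nondown_paths :: "nat \<Rightarrow> int \<Rightarrow> nat \<Rightarrow> (int \<times> int) list set" where
  "nondown_paths t h n = {p \<in> strip_paths t h n. p = [] \<or> hd p \<notin> down_steps}"

lemma down_steps_iff: "s \<in> down_steps \<longleftrightarrow> fst s = 1 \<and> snd s < 0"
proof
  assume "fst s = 1 \<and> snd s < 0"
  then have "s = (1, - (- snd s))" "- snd s \<ge> 1"
    by (simp_all add: prod_eq_iff)
  then show "s \<in> down_steps"
    unfolding down_steps_def by blast
qed (auto simp: down_steps_def)

lemma up_step_notin_down_steps: "up_step \<notin> down_steps"
  by (simp add: up_step_def down_steps_iff)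

lemma bounded_gdaps_eq_strip_paths: "bounded_gdaps t n = strip_paths t 0 n"
proof -
  have *: "- int t \<le> k \<and> k \<le> int t \<longleftrightarrow> \<bar>k\<bar> \<le> int t" for k
    by auto
  have "(\<forall>v \<in> path_vertices p. - int t \<le> snd v \<and> snd v \<le> int t) \<longleftrightarrow>
      (\<forall>i \<le> length p. \<bar>snd (sum_list (take i p))\<bar> \<le> int t)" for p
    unfolding path_vertices_def * by blast
  then show ?thesis
    unfolding bounded_gdaps_def strip_paths_def gdap_def
    by (intro Collect_cong) (simp only: add_0_left conj_ac)
qed

lemma strip_paths_outside: "\<bar>h\<bar> > int t \<Longrightarrow> strip_paths t h n = {}"
  by (auto simp: strip_paths_def dest!: spec[where x = 0])

lemma strip_paths_0: "\<bar>h\<bar> \<le> int t \<Longrightarrow> strip_paths t h 0 = (if h = 0 then {[]} else {})"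
  by (auto simp: strip_paths_def)

text \<open>The empty prefix of \<open>s # p\<close> bounds \<open>h\<close>; every other prefix is
  \<open>s\<close> followed by a prefix of \<open>p\<close>, which moves the start to
  \<open>h + snd s\<close>. Only a down-step restricts what follows.\<close>

lemma Cons_in_strip_paths_iff:
  "s # p \<in> strip_paths t h (Suc n) \<longleftrightarrow>
     \<bar>h\<bar> \<le> int t \<and> s \<in> insert up_step down_steps \<and>
     p \<in> (if s \<in> down_steps then nondown_paths else strip_paths) t (h + snd s) n"
proof -
  have all_Suc: "(\<forall>i \<le> Suc k. P i) \<longleftrightarrow> P 0 \<and> (\<forall>i \<le> k. P (Suc i))" for P and k :: nat
    by (metis Suc_le_mono not0_implies_Suc zero_le)
  show ?thesis
    by (cases p) (auto simp: strip_paths_def nondown_paths_def all_Suc add.assoc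
        up_step_notin_down_steps)
qed

lemma nondown_paths_Suc:
  assumes "\<bar>h\<bar> \<le> int t"
  shows "nondown_paths t h (Suc n) = Cons up_step ` strip_paths t (h + 1) n"
proof (intro set_eqI)
  fix p
  show "p \<in> nondown_paths t h (Suc n) \<longleftrightarrow> p \<in> Cons up_step ` strip_paths t (h + 1) n"
  proof (cases p)
    case Nil
    then show ?thesis by (auto simp: nondown_paths_def strip_paths_def)
  next
    case (Cons s q)
    then show ?thesis
      using assms up_step_notin_down_steps
      by (auto simp: nondown_paths_def Cons_in_strip_paths_iff up_step_def)
  qed
qed

text \<open>A leading down-step is determined by the height \<open>j\<close> at which it lands, and
  the strip leaves only finitely many \<open>j\<close> below \<open>h\<close>.\<close>

lemma strip_paths_Suc:
  assumes "\<bar>h\<bar> \<le> int t"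
  shows "strip_paths t h (Suc n) = nondown_paths t h (Suc n) \<union>
           (\<Union>j \<in> {- int t..<h}. Cons (1, j - h) ` nondown_paths t j n)"
proof (intro set_eqI)
  fix p
  have outside: "j \<ge> - int t" if "q \<in> nondown_paths t j n" for j q
  proof -
    have "q \<in> strip_paths t j n"
      using that by (simp add: nondown_paths_def)
    then have "\<not> \<bar>j\<bar> > int t"
      using strip_paths_outside by blast
    then show ?thesis by linarith
  qed
  show "p \<in> strip_paths t h (Suc n) \<longleftrightarrow> p \<in> nondown_paths t h (Suc n) \<union>
           (\<Union>j \<in> {- int t..<h}. Cons (1, j - h) ` nondown_paths t j n)"
  proof (cases p)
    case Nil
    then show ?thesis by (auto simp: nondown_paths_def strip_paths_def)
  next
    case (Cons s q)
    show ?thesis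
    proof (cases "s \<in> down_steps")
      case True
      then have "s = (1, snd s)" "snd s < 0"
        by (simp_all add: down_steps_iff prod_eq_iff)
      then have j: "s = (1, j - h) \<longleftrightarrow> j = h + snd s" for j
        by (metis add_diff_cancel_left' diff_add_cancel add.commute snd_conv)
      have "p \<in> strip_paths t h (Suc n) \<longleftrightarrow> q \<in> nondown_paths t (h + snd s) n"
        using Cons True assms by (simp add: Cons_in_strip_paths_iff)
      moreover have "p \<notin> nondown_paths t h (Suc n)"
        using Cons True by (simp add: nondown_paths_def)
      moreover have "p \<in> (\<Union>j \<in> {- int t..<h}. Cons (1, j - h) ` nondown_paths t j n)
          \<longleftrightarrow> q \<in> nondown_paths t (h + snd s) n"
      proof -
        have "p \<in> Cons (1, j - h) ` nondown_paths t j n \<longleftrightarrow>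
            j = h + snd s \<and> q \<in> nondown_paths t j n" for j
          unfolding Cons j[symmetric] by blast
        moreover have "h + snd s \<in> {- int t..<h}" if "q \<in> nondown_paths t (h + snd s) n"
          using outside[OF that] \<open>snd s < 0\<close> by simp
        ultimately show ?thesis
          unfolding UN_iff by metis
      qed
      ultimately show ?thesis by simp
    next
      case False
      have "p \<notin> (\<Union>j \<in> {- int t..<h}. Cons (1, j - h) ` nondown_paths t j n)"
      proof -
        have "s \<noteq> (1, j - h)" if "j \<in> {- int t..<h}" for j
          using False that by (auto simp: down_steps_iff)
        then show ?thesis
          unfolding Cons by blast
      qed
      moreover have "p \<in> strip_paths t h (Suc n) \<longleftrightarrow> p \<in> nondown_paths t h (Suc n)"
        by (simp add: nondown_paths_def Cons False)
      ultimately show ?thesis by simp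
    qed
  qed
qed

lemma finite_strip_paths: "finite (strip_paths t h n)"
proof (induction n arbitrary: h)
  case 0
  show ?case by (cases "\<bar>h\<bar> \<le> int t") (auto simp: strip_paths_0 strip_paths_outside)
next
  case (Suc n)
  have "finite (nondown_paths t j n)" for j
    using Suc by (simp add: nondown_paths_def)
  then show ?case
    using Suc by (cases "\<bar>h\<bar> \<le> int t")
      (auto simp: strip_paths_Suc nondown_paths_Suc strip_paths_outside)
qed

lemma finite_nondown_paths: "finite (nondown_paths t h n)"
  by (simp add: nondown_paths_def finite_strip_paths)

lemma card_nondown_paths_Suc:
  "\<bar>h\<bar> \<le> int t \<Longrightarrow> card (nondown_paths t h (Suc n)) = card (strip_paths t (h + 1) n)"
  by (simp add: nondown_paths_Suc card_image)

lemma card_strip_paths_Suc: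
  assumes "\<bar>h\<bar> \<le> int t"
  shows "card (strip_paths t h (Suc n)) =
           card (nondown_paths t h (Suc n)) + (\<Sum>j \<in> {- int t..<h}. card (nondown_paths t j n))"
proof -
  let ?B = "\<lambda>j. Cons (1, j - h) ` nondown_paths t j n"
  have "card (\<Union>j \<in> {- int t..<h}. ?B j) = (\<Sum>j \<in> {- int t..<h}. card (?B j))"
    by (rule card_UN_disjoint) (auto simp: finite_nondown_paths)
  also have "\<dots> = (\<Sum>j \<in> {- int t..<h}. card (nondown_paths t j n))"
    by (simp add: card_image)
  finally have B: "card (\<Union>j \<in> {- int t..<h}. ?B j) =
      (\<Sum>j \<in> {- int t..<h}. card (nondown_paths t j n))" .
  show ?thesis
    unfolding strip_paths_Suc[OF assms] B[symmetric]
    by (rule card_Un_disjoint)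
       (auto simp: finite_nondown_paths finite_strip_paths nondown_paths_Suc[OF assms] up_step_def)
qed

section \<open>Generating functions by starting height\<close>

definition strip_gf :: "nat \<Rightarrow> int \<Rightarrow> real fps" where
  "strip_gf t h = Abs_fps (\<lambda>n. of_nat (card (strip_paths t h n)))"

definition nondown_gf :: "nat \<Rightarrow> int \<Rightarrow> real fps" where
  "nondown_gf t h = Abs_fps (\<lambda>n. of_nat (card (nondown_paths t h n)))"

lemma strip_gf_outside: "\<bar>h\<bar> > int t \<Longrightarrow> strip_gf t h = 0"
  by (simp add: strip_gf_def strip_paths_outside fps_zero_def)

lemma nondown_gf_eq:
  assumes "\<bar>h\<bar> \<le> int t"
  shows "nondown_gf t h = of_bool (h = 0) + fps_X * strip_gf t (h + 1)"
proof (rule fps_ext)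
  fix n
  show "fps_nth (nondown_gf t h) n =
      fps_nth (of_bool (h = 0) + fps_X * strip_gf t (h + 1)) n"
  proof (cases n)
    case 0
    have "nondown_paths t h 0 = (if h = 0 then {[]} else {})"
      using assms by (auto simp: nondown_paths_def strip_paths_0)
    with 0 show ?thesis by (simp add: nondown_gf_def)
  next
    case (Suc m)
    with assms show ?thesis
      by (simp add: nondown_gf_def strip_gf_def card_nondown_paths_Suc)
  qed
qed

lemma strip_gf_eq:
  assumes "\<bar>h\<bar> \<le> int t"
  shows "strip_gf t h = nondown_gf t h + fps_X * (\<Sum>j \<in> {- int t..<h}. nondown_gf t j)"
proof (rule fps_ext)
  fix n
  show "fps_nth (strip_gf t h) n =
      fps_nth (nondown_gf t h + fps_X * (\<Sum>j \<in> {- int t..<h}. nondown_gf t j)) n"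
  proof (cases n)
    case 0
    have "nondown_paths t h 0 = strip_paths t h 0"
      using assms by (auto simp: nondown_paths_def strip_paths_0)
    with 0 show ?thesis by (simp add: nondown_gf_def strip_gf_def)
  next
    case (Suc m)
    with assms show ?thesis
      by (simp add: nondown_gf_def strip_gf_def card_strip_paths_Suc fps_sum_nth)
  qed
qed

text \<open>No down-step fits at the bottom, and \<open>t \<ge> 1\<close> keeps the bottom away from
  height 0, so the empty path does not contribute.\<close>

lemma strip_gf_bottom:
  assumes "t \<ge> 1"
  shows "strip_gf t (- int t) = fps_X * strip_gf t (1 - int t)"
proof -
  have *: "- int t + 1 = 1 - int t"
    by simp
  have "nondown_gf t (- int t) = fps_X * strip_gf t (1 - int t)"
    using nondown_gf_eq[of "- int t" t] unfolding * using assms by simp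
  then show ?thesis
    using strip_gf_eq[of "- int t" t] by simp
qed

lemma strip_gf_recurrence:
  assumes "- int t \<le> h" "h < int t"
  shows "strip_gf t h = (1 + fps_X - fps_X ^ 2) * strip_gf t (h + 1) - fps_X * strip_gf t (h + 2)
           - of_bool (h = -1) + (1 - fps_X) * of_bool (h = 0)"
proof -
  have "{- int t..<h + 1} = insert h {- int t..<h}"
    using assms by auto
  then have 1: "strip_gf t (h + 1) = nondown_gf t (h + 1) +
      fps_X * (nondown_gf t h + (\<Sum>j \<in> {- int t..<h}. nondown_gf t j))"
    using assms strip_gf_eq[of "h + 1" t] by simp
  have 2: "strip_gf t h = nondown_gf t h + fps_X * (\<Sum>j \<in> {- int t..<h}. nondown_gf t j)"
    using assms by (intro strip_gf_eq) auto
  \<comment> \<open>Subtracting \<open>2\<close> from \<open>1\<close> cancels the sum over the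
    heights below \<open>h\<close>.\<close>
  have *: "strip_gf t h = strip_gf t (h + 1) - nondown_gf t (h + 1) + (1 - fps_X) * nondown_gf t h"
    unfolding 1 2 by (simp only: distrib_left left_diff_distrib) simp
  have up: "nondown_gf t (h + 1) = of_bool (h = -1) + fps_X * strip_gf t (h + 2)"
  proof -
    have "\<bar>h + 1\<bar> \<le> int t" "h + 1 = 0 \<longleftrightarrow> h = -1" "h + 1 + 1 = h + 2"
      using assms by auto
    then show ?thesis
      using nondown_gf_eq[of "h + 1" t] by (simp only:)
  qed
  have here: "nondown_gf t h = of_bool (h = 0) + fps_X * strip_gf t (h + 1)"
    using assms by (intro nondown_gf_eq) auto
  show ?thesis
    unfolding * up here by (simp add: ring_distribs power2_eq_square mult.assoc)
qed

section \<open>The polynomial recurrence\<close>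

text \<open>The Lucas sequence of the first kind with parameters
  \<open>1 + fps_X - fps_X ^ 2\<close> and \<open>fps_X\<close>.\<close>

fun U_seq :: "nat \<Rightarrow> real fps" where
  "U_seq 0 = 0"
| "U_seq (Suc 0) = 1"
| "U_seq (Suc (Suc s)) = (1 + fps_X - fps_X ^ 2) * U_seq (Suc s) - fps_X * U_seq s"

text \<open>Both sides satisfy the recurrence and agree for \<open>k = 0\<close> and
  \<open>k = 1\<close>. The bound \<open>n\<close> allows for sequences of heights that obey it only
  on one side of the origin.\<close>

lemma recurrence_solution:
  fixes A :: "nat \<Rightarrow> real fps"
  assumes "\<And>k. k < n \<Longrightarrow> A (k + 2) = (1 + fps_X - fps_X ^ 2) * A (k + 1) - fps_X * A k"
    and "k \<le> n"
  shows "A (Suc k) = U_seq (Suc k) * A 1 - fps_X * U_seq k * A 0"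
  using \<open>k \<le> n\<close>
proof (induction k rule: induct_nat_012)
  case (ge2 k)
  have "A (Suc (Suc (Suc k))) = (1 + fps_X - fps_X ^ 2) * A (Suc (Suc k)) - fps_X * A (Suc k)"
    using assms(1)[of "Suc k"] ge2.prems by simp
  also have "\<dots> = U_seq (Suc (Suc (Suc k))) * A 1 - fps_X * U_seq (Suc (Suc k)) * A 0"
    using ge2 by (simp only: U_seq.simps) (simp add: algebra_simps)
  finally show ?case .
qed (use assms(1)[of 0] in simp_all)

definition D_fps :: "nat \<Rightarrow> real fps" where
  "D_fps s = fps_of_poly (D_poly s)"

lemma D_fps_0: "D_fps 0 = 1"
  by (simp add: D_fps_def)

lemma D_fps_Suc_Suc: "D_fps (Suc (Suc s)) = (1 + fps_X - fps_X ^ 2) * D_fps (Suc s) - fps_X * D_fps s"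
  by (simp add: D_fps_def fps_of_poly_simps fps_of_poly_monom algebra_simps)

lemma D_fps_1: "D_fps (Suc 0) = 1 - fps_X ^ 2"
  by (simp add: D_fps_def fps_of_poly_simps fps_of_poly_monom)

lemma D_fps_eq_U_seq: "D_fps s = U_seq (Suc s) - fps_X * U_seq s"
proof (induction s rule: induct_nat_012)
  case (ge2 s)
  then show ?case
    by (simp only: D_fps_Suc_Suc U_seq.simps) (simp add: algebra_simps)
qed (simp_all add: D_fps_0 D_fps_1)

text \<open>This lets \<open>D_fps s + fps_X ^ 2 * U_seq s\<close> stand for the term of index
  \<open>s - 1\<close>, also at \<open>s = 0\<close>, where it continues the sequence backwards by
  the value 1.\<close>

lemma D_fps_Suc_plus_U_seq: "D_fps (Suc s) + fps_X ^ 2 * U_seq (Suc s) = D_fps s"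
  by (simp add: D_fps_eq_U_seq algebra_simps power2_eq_square)

lemma D_fps_add: "D_fps (Suc s + k) = U_seq (Suc k) * D_fps (Suc s) - fps_X * U_seq k * D_fps s"
  using recurrence_solution[of k "\<lambda>k. D_fps (s + k)" k]
  by (simp add: D_fps_Suc_Suc)

lemma D_fps_nonzero: "D_fps s \<noteq> 0"
proof -
  have "fps_nth (D_fps s) 0 = 1"
    by (induction s rule: induct_nat_012)
       (simp_all add: D_fps_0 D_fps_1 D_fps_Suc_Suc power2_eq_square)
  then show ?thesis by auto
qed

lemma strip_gf_origin:
  assumes "t \<ge> 1"
  shows "D_fps (2 * t) * strip_gf t 0 = D_fps (t - 1) * (D_fps t + fps_X ^ 2 * U_seq t)"
proof -
  obtain s where t: "t = Suc s"
    using assms by (cases t) auto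
  let ?F = "strip_gf t" and ?a = "1 + fps_X - fps_X ^ 2 :: real fps" and ?X = "fps_X :: real fps"
  \<comment> \<open>Going down from height \<open>t + 1\<close>, where \<open>?F\<close> vanishes,
    only the \<open>U_seq (Suc k)\<close> term survives. For \<open>k \<le> s\<close> the recurrence
    is used at heights at least 1, where it is homogeneous.\<close>
  have upper: "?F (int t - int k) = U_seq (Suc k) * ?F (int t)" if "k \<le> s" for k
  proof -
    have *: "?F (int t + 1 - int (j + 2)) =
        ?a * ?F (int t + 1 - int (j + 1)) - ?X * ?F (int t + 1 - int j)" if "j < s" for j
      using that t strip_gf_recurrence[of t "int t + 1 - int (j + 2)"] by (simp add: algebra_simps)
    have "?F (int t + 1 - int (Suc k)) = U_seq (Suc k) * ?F (int t + 1 - int 1)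
        - ?X * U_seq k * ?F (int t + 1 - int 0)"
      by (rule recurrence_solution[OF * that])
    then show ?thesis by (simp add: strip_gf_outside)
  qed
  have F1: "?F 1 = U_seq t * ?F (int t)"
    using upper[of s] t by simp
  have F2: "?F 2 = U_seq s * ?F (int t)"
    using upper[of "s - 1"] t by (cases s) (simp_all add: strip_gf_outside)
  have F0: "?F 0 = U_seq (Suc t) * ?F (int t) + (1 - ?X)"
  proof -
    have "?F 0 = ?a * ?F 1 - ?X * ?F 2 + (1 - ?X)"
      using strip_gf_recurrence[of t 0] t by simp
    also have "\<dots> = (?a * U_seq t - ?X * U_seq s) * ?F (int t) + (1 - ?X)"
      unfolding F1 F2 by (simp only: algebra_simps)
    finally show ?thesis by (simp add: t)
  qed
  have Fm1: "?F (-1) = ?a * ?F 0 - ?X * ?F 1 - 1"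
    using strip_gf_recurrence[of t "-1"] t by simp
  have lower: "?F (- int (Suc k)) = U_seq (Suc k) * ?F (-1) - ?X * U_seq k * ?F 0"
    if "k \<le> s" for k
  proof -
    have *: "?F (- int (j + 2)) = ?a * ?F (- int (j + 1)) - ?X * ?F (- int j)" if "j < s" for j
      using that t strip_gf_recurrence[of t "- int (j + 2)"] by (simp add: algebra_simps)
    have "?F (- int (Suc k)) = U_seq (Suc k) * ?F (- int 1) - ?X * U_seq k * ?F (- int 0)"
      by (rule recurrence_solution[OF * that])
    then show ?thesis by simp
  qed
  \<comment> \<open>Insert \<open>lower\<close> into the boundary condition at \<open>- t\<close>.
    For \<open>s = 0\<close> the truncated \<open>s - 1\<close> makes the first summand vanish, and
    the \<open>of_bool\<close> term supplies the correct value.\<close>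
  have "D_fps s * ?F (-1) = ?X * (?F 0 * (U_seq s - ?X * U_seq (s - 1)) + of_bool (s = 0) * ?F 0)"
  proof (cases s)
    case 0
    then show ?thesis
      using strip_gf_bottom[of t] t by (simp add: D_fps_0)
  next
    case (Suc r)
    have "?F (- int t) = ?X * ?F (- int s)"
      using strip_gf_bottom[of t] t by simp
    then show ?thesis
      using lower[of s] lower[of r] Suc t
      by (simp only: D_fps_eq_U_seq) (simp add: algebra_simps del: U_seq.simps)
  qed
  also have "(?F 0 * (U_seq s - ?X * U_seq (s - 1)) + of_bool (s = 0) * ?F 0)
      = ?F 0 * (D_fps s + ?X ^ 2 * U_seq s)"
  proof (cases s)
    case (Suc r)
    then show ?thesis
      by (simp add: D_fps_Suc_plus_U_seq) (simp add: D_fps_eq_U_seq)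
  qed (simp add: D_fps_0)
  finally have bottom: "D_fps s * ?F (-1) = ?X * (?F 0 * (D_fps s + ?X ^ 2 * U_seq s))" .
  \<comment> \<open>The recurrence for \<open>D_fps\<close>, with its term of index
    \<open>s - 1\<close> rewritten, lets \<open>bottom\<close> and \<open>Fm1\<close> eliminate
    \<open>?F (-1)\<close>.\<close>
  have "D_fps t * ?F 0 = (?a * D_fps s - ?X * (D_fps s + ?X ^ 2 * U_seq s)) * ?F 0"
    by (simp only: t D_fps_eq_U_seq U_seq.simps) (simp add: algebra_simps power2_eq_square)
  also have "\<dots> = D_fps s * (?X * U_seq t * ?F (int t) + 1)"
    using bottom unfolding Fm1 F1 by (simp add: algebra_simps)
  finally have middle: "D_fps t * ?F 0 = D_fps s * (?X * U_seq t * ?F (int t) + 1)" .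
  have "D_fps (2 * t) = U_seq (Suc t) * D_fps t - ?X * U_seq t * D_fps s"
    using D_fps_add[of s t] t by (simp del: U_seq.simps add: mult_2)
  then have "D_fps (2 * t) * ?F 0 = U_seq (Suc t) * (D_fps t * ?F 0) - ?X * U_seq t * D_fps s * ?F 0"
    by (simp only: ring_distribs mult.assoc)
  also have "\<dots> = D_fps s * (?X * U_seq t * (U_seq (Suc t) * ?F (int t) - ?F 0) + U_seq (Suc t))"
    unfolding middle by (simp only: algebra_simps mult_1_left)
  \<comment> \<open>Here the unknown \<open>?F (int t)\<close> drops out.\<close>
  also have "U_seq (Suc t) * ?F (int t) - ?F 0 = ?X - 1"
    unfolding F0 by simp
  also have "?X * U_seq t * (?X - 1) + U_seq (Suc t) = D_fps t + ?X ^ 2 * U_seq t"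
    by (simp only: D_fps_eq_U_seq) (simp only: algebra_simps power2_eq_square mult_1_left)
  finally show ?thesis by (simp add: t)
qed

section \<open>The closed form of N\<close>

lemma N_fls_eq: "N_fls t = fps_to_fls (fps_X ^ 2 * U_seq t)"
proof -
  define a :: "real fls" where "a = fls_X ^ 2 - fls_X - 1"
  \<comment> \<open>\<open>r\<close> and \<open>s\<close> are the roots of
    \<open>y ^ 2 + a * y + fls_X\<close>, the characteristic polynomial of
    \<open>U_seq\<close>.\<close>
  define r where "r = (W_fls - a) / 2"
  define s where "s = (- W_fls - a) / 2"
  have W2: "W_fls ^ 2 = fls_X ^ 4 - 2 * fls_X ^ 3 - fls_X ^ 2 - 2 * fls_X + 1"
  proof -
    have "W_fls ^ 2 = fps_to_fls (W_fps ^ 2)"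
      by (simp add: W_fls_def fps_to_fls_power)
    then show ?thesis
      by (simp add: W_fps_square fls_times_fps_to_fls fps_to_fls_power flip: fps_to_fls_numeral)
  qed
  have W0: "W_fls \<noteq> 0"
    using W_fps_nth_0 by (auto simp: W_fls_def)
  have aW: "a ^ 2 - W_fls ^ 2 = 4 * fls_X"
    unfolding W2 a_def by (simp add: power2_eq_square power3_eq_cube power4_eq_xxxx algebra_simps)
  have sum: "r + s = - a" and diff: "r - s = W_fls"
    by (simp_all add: r_def s_def field_simps)
  have prod: "r * s = fls_X"
    using aW by (simp add: r_def s_def field_simps power2_eq_square)
  then have nz: "r \<noteq> 0" "s \<noteq> 0"
    by auto
  have a_eq: "fps_to_fls (1 + fps_X - fps_X ^ 2 :: real fps) = - a"
    by (simp add: a_def fps_to_fls_power)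
  have binet: "W_fls * fps_to_fls (U_seq k) = r ^ k - s ^ k" for k
  proof (induction k rule: induct_nat_012)
    case (ge2 k)
    have "W_fls * fps_to_fls (U_seq (Suc (Suc k))) =
        (r + s) * (W_fls * fps_to_fls (U_seq (Suc k))) - (r * s) * (W_fls * fps_to_fls (U_seq k))"
      unfolding U_seq.simps sum prod a_eq[symmetric]
      by (simp add: fls_times_fps_to_fls right_diff_distrib mult.left_commute)
    then show ?case
      unfolding ge2 by (simp add: algebra_simps)
  qed (simp_all add: diff)
  have den: "W_fls * a ^ 2 - W_fls ^ 3 = 4 * fls_X * W_fls"
    unfolding aW[symmetric] by (simp add: algebra_simps power2_eq_square power3_eq_cube)
  have "N_fls t = 2 ^ (t + 2) * fls_X ^ (t + 3) * (- 1) ^ t / (4 * fls_X * W_fls)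
      * (1 / (- 2 * s) ^ t - 1 / (- 2 * r) ^ t)"
  proof -
    have "a + W_fls = - 2 * s" "a - W_fls = - 2 * r"
      by (simp_all add: r_def s_def field_simps)
    then show ?thesis
      unfolding N_fls_def a_def[symmetric] den by simp
  qed
  \<comment> \<open>Over a common denominator the reciprocals give the Binet numerator, and
    \<open>r * s = fls_X\<close> turns the denominator into a monomial.\<close>
  also have "1 / (- 2 * s) ^ t - 1 / (- 2 * r) ^ t = (r ^ t - s ^ t) / ((- 2) ^ t * (r * s) ^ t)"
    unfolding power_mult_distrib using nz by (simp add: field_simps)
  also have "\<dots> = W_fls * fps_to_fls (U_seq t) / ((- 1) ^ t * 2 ^ t * fls_X ^ t)"
    unfolding binet prod by (simp add: power_minus[of 2])
  also have "2 ^ (t + 2) * fls_X ^ (t + 3) * (- 1) ^ t / (4 * fls_X * W_fls) * \<dots> =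
      fls_X ^ 2 * fps_to_fls (U_seq t)"
    using W0 by (simp add: field_simps power_add power2_eq_square power3_eq_cube)
  finally show ?thesis
    by (simp add: fls_times_fps_to_fls fps_to_fls_power)
qed

theorem theorem6:
  fixes t :: nat
  assumes "t \<ge> 1"
  shows "fps_to_fls (bounded_gdap_gf t) = D_fls (t - 1) / D_fls (2 * t) * (D_fls t + N_fls t)"
proof -
  have "bounded_gdap_gf t = strip_gf t 0"
    by (simp add: bounded_gdap_gf_def strip_gf_def bounded_gdaps_eq_strip_paths)
  moreover have D: "D_fls s = fps_to_fls (D_fps s)" for s
    by (simp add: D_fls_def D_fps_def)
  moreover have "D_fls (2 * t) \<noteq> 0"
    by (simp add: D D_fps_nonzero)
  ultimately show ?thesis
    using arg_cong[OF strip_gf_origin[OF assms], of fps_to_fls]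
    by (simp add: N_fls_eq fls_times_fps_to_fls field_simps)
qed

end
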